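(* Let $K(\mathcal{M})$ be a Kripke model with classical domains. If there are nodes $v < w$ in $K$ such that $\mathcal{M}_w$ is a non-trivial generic extension of $\mathcal{M}_v$ (i.e., $\mathcal{M}_w = \mathcal{M}_v[G]$ for some generic $G \notin \mathcal{M}_v$), then $K(\mathcal{M})$ is not a model of $\mathsf{CZF}$ (i.e. $K(\mathcal{M})$ does not force all axioms of $\mathsf{CZF}$).
   Context: A Kripke frame $(K,\leq)$ is a set $K$ with a partial order $\leq$. A sound assignment for $K$ is a map $v \mapsto \mathcal{M}_v$ assigning to every node $v \in K$ a transitive model $\mathcal{M}_v$ of $\mathsf{ZF}$ such that, for $v \leq w$, $\mathcal{M}_v \subseteq \mathcal{M}_w$ and membership and equality statements true in $\mathcal{M}_v$ remain true in $\mathcal{M}_w$. The Kripke model with classical domains $K(\mathcal{M})$ has underlying frame $(K,\leq)$, domain $\mathcal{M}_v$ at node $v$, and membership relation at $v$ the restriction of $\in$ to $\mathcal{M}_v$. Forcing for formulas of the language of set theory with parameters in $\mathcal{M}_v$: $v \Vdash a \in b$ iff $a \in b$; $v \Vdash a = b$ iff $a = b$; $\wedge$ and $\vee$ are evaluated pointwise at $v$; $v \Vdash \varphi \rightarrow \psi$ iff for all $w \geq v$, $w \Vdash \varphi$ implies $w \Vdash \psi$; $v \Vdash \bot$ never; $v \Vdash \exists x\, \varphi(x)$ iff $v \Vdash \varphi(a)$ for some $a \in \mathcal{M}_v$; $v \Vdash \forall x\, \varphi(x)$ iff for all $w \geq v$ and all $a \in \mathcal{M}_w$, $w \Vdash \varphi(a)$.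 $K(\mathcal{M}) \Vdash \varphi$ means $v \Vdash \varphi$ for all $v \in K$. $\mathsf{CZF}$ is the theory over intuitionistic first-order logic in the language with $\in, =$ with axioms Extensionality, Empty Set, Pairing, Union; Strong Infinity $\exists a (\mathrm{Ind}(a) \wedge \forall b (\mathrm{Ind}(b) \rightarrow \forall x \in a\, (x \in b)))$ where $\mathrm{Ind}(a)$ is $\emptyset \in a \wedge \forall x \in a \exists y \in a\; y = \{x\}$; Set Induction $(\forall a (\forall x \in a\, \varphi(x) \rightarrow \varphi(a))) \rightarrow \forall a\, \varphi(a)$; Separation for bounded formulas; Strong Collection $\forall a (\forall x \in a \exists y\, \varphi(x,y) \rightarrow \exists b (\forall x \in a \exists y \in b\, \varphi(x,y) \wedge \forall y \in b \exists x \in a\, \varphi(x,y)))$ for all formulas $\varphi$; and Subset Collection $\forall a \forall b \exists c \forall u (\forall x \in a \exists y \in b\, \psi(x,y,u) \rightarrow \exists d \in c (\forall x \in a \exists y \in d\, \psi(x,y,u) \wedge \forall y \in d \exists x \in a\, \psi(x,y,u)))$ for all formulas $\psi$. *)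

theory Defs
  imports Main
begin

section \<open>Formulas of the language of set theory\<close>

text \<open>Variables are de Bruijn indices: index 0 refers to the innermost quantifier, and the free
  variables of a formula are the indices that point beyond all its quantifiers.\<close>

datatype fm =
    Mem nat nat
  | Eql nat nat
  | Bot
  | Conj fm fm
  | Disj fm fm
  | Impl fm fm
  | Forall fm
  | Exists fm

definition Iff :: "fm \<Rightarrow> fm \<Rightarrow> fm" where
  "Iff \<phi> \<psi> = Conj (Impl \<phi> \<psi>) (Impl \<psi> \<phi>)"

text \<open>In the bounded quantifiers the bound \<open>a\<close> is counted outside the new binder.\<close>

definition ForallIn :: "nat \<Rightarrow> fm \<Rightarrow> fm" where
  "ForallIn a \<phi> = Forall (Impl (Mem 0 (Suc a)) \<phi>)"

definition ExistsIn :: "nat \<Rightarrow> fm \<Rightarrow> fm" where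
  "ExistsIn a \<phi> = Exists (Conj (Mem 0 (Suc a)) \<phi>)"

inductive bounded_fm :: "fm \<Rightarrow> bool" where
  "bounded_fm (Mem i j)"
| "bounded_fm (Eql i j)"
| "bounded_fm Bot"
| "bounded_fm \<phi> \<Longrightarrow> bounded_fm \<psi> \<Longrightarrow> bounded_fm (Conj \<phi> \<psi>)"
| "bounded_fm \<phi> \<Longrightarrow> bounded_fm \<psi> \<Longrightarrow> bounded_fm (Disj \<phi> \<psi>)"
| "bounded_fm \<phi> \<Longrightarrow> bounded_fm \<psi> \<Longrightarrow> bounded_fm (Impl \<phi> \<psi>)"
| "bounded_fm \<phi> \<Longrightarrow> bounded_fm (ForallIn a \<phi>)"
| "bounded_fm \<phi> \<Longrightarrow> bounded_fm (ExistsIn a \<phi>)"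

primrec rename :: "(nat \<Rightarrow> nat) \<Rightarrow> fm \<Rightarrow> fm" where
  "rename f (Mem i j) = Mem (f i) (f j)"
| "rename f (Eql i j) = Eql (f i) (f j)"
| "rename f Bot = Bot"
| "rename f (Conj \<phi> \<psi>) = Conj (rename f \<phi>) (rename f \<psi>)"
| "rename f (Disj \<phi> \<psi>) = Disj (rename f \<phi>) (rename f \<psi>)"
| "rename f (Impl \<phi> \<psi>) = Impl (rename f \<phi>) (rename f \<psi>)"
| "rename f (Forall \<phi>) = Forall (rename (case_nat 0 (\<lambda>i. Suc (f i))) \<phi>)"
| "rename f (Exists \<phi>) = Exists (rename (case_nat 0 (\<lambda>i. Suc (f i))) \<phi>)"

text \<open>\<open>inst d xs \<phi>\<close> is \<open>\<phi>(x\<^sub>1, \<dots>, x\<^sub>k)\<close> placed under \<open>d\<close> quantifiers: the first \<open>k\<close> free variables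
  of \<open>\<phi>\<close> become the variables listed in \<open>xs\<close>, and the remaining ones, the parameters of \<open>\<phi>\<close>, are
  shifted past the \<open>d\<close> quantifiers, so that they are not captured.\<close>

definition inst :: "nat \<Rightarrow> nat list \<Rightarrow> fm \<Rightarrow> fm" where
  "inst d xs \<phi> = rename (\<lambda>i. if i < length xs then xs ! i else i - length xs + d) \<phi>"

text \<open>All free variables of \<open>\<phi>\<close> are less than \<open>fv_bound \<phi>\<close>.\<close>

primrec fv_bound :: "fm \<Rightarrow> nat" where
  "fv_bound (Mem i j) = Suc (max i j)"
| "fv_bound (Eql i j) = Suc (max i j)"
| "fv_bound Bot = 0"
| "fv_bound (Conj \<phi> \<psi>) = max (fv_bound \<phi>) (fv_bound \<psi>)"
| "fv_bound (Disj \<phi> \<psi>) = max (fv_bound \<phi>) (fv_bound \<psi>)"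
| "fv_bound (Impl \<phi> \<psi>) = max (fv_bound \<phi>) (fv_bound \<psi>)"
| "fv_bound (Forall \<phi>) = fv_bound \<phi> - 1"
| "fv_bound (Exists \<phi>) = fv_bound \<phi> - 1"

definition univ_closure :: "fm \<Rightarrow> fm" where
  "univ_closure \<phi> = (Forall ^^ fv_bound \<phi>) \<phi>"


section \<open>Axioms\<close>

text \<open>A comment such as \<open>y x a\<close> lists the variables in scope at the innermost formula on that line:
  index 0 is \<open>y\<close>, index 1 is \<open>x\<close>, index 2 is \<open>a\<close>, in the usual notation for the axiom.\<close>

definition Extensionality :: fm where
  "Extensionality = Forall (Forall (Impl (Forall (Iff (Mem 0 2) (Mem 0 1))) (Eql 1 0)))"

definition Empty_Set :: fm where
  "Empty_Set = Exists (ForallIn 0 Bot)"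

definition Pairing :: fm where
  "Pairing = Forall (Forall (Exists (Forall
     (Iff (Mem 0 1) (Disj (Eql 0 3) (Eql 0 2))))))" \<comment> \<open>x y b a\<close>

definition Union_Axiom :: fm where
  "Union_Axiom = Forall (Exists (Forall (Iff (Mem 0 1) (ExistsIn 2 (Mem 1 0)))))" \<comment> \<open>u x y a\<close>

definition Ind :: "nat \<Rightarrow> fm" where
  "Ind a = Conj (ExistsIn a (ForallIn 0 Bot))
     (ForallIn a (ExistsIn (Suc a) (Forall (Iff (Mem 0 1) (Eql 0 2)))))" \<comment> \<open>z y x; y = {x}\<close>

definition Strong_Infinity :: fm where
  "Strong_Infinity = Exists (Conj (Ind 0)
     (Forall (Impl (Ind 0) (ForallIn 1 (Mem 0 1)))))" \<comment> \<open>x b a\<close>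

definition Set_Induction :: "fm \<Rightarrow> fm" where
  "Set_Induction \<phi> =
     Impl (Forall (Impl (ForallIn 0 (inst 2 [0] \<phi>)) (inst 1 [0] \<phi>))) (Forall (inst 1 [0] \<phi>))"

definition Separation :: "fm \<Rightarrow> fm" where
  "Separation \<phi> = Forall (Exists (Forall
     (Iff (Mem 0 1) (Conj (Mem 0 2) (inst 3 [0] \<phi>)))))" \<comment> \<open>x y a\<close>

definition Strong_Collection :: "fm \<Rightarrow> fm" where
  "Strong_Collection \<phi> = Forall (Impl
     (ForallIn 0 (Exists (inst 3 [1, 0] \<phi>))) \<comment> \<open>y x a\<close>
     (Exists (Conj
        (ForallIn 1 (ExistsIn 1 (inst 4 [1, 0] \<phi>))) \<comment> \<open>y x b a\<close>
        (ForallIn 0 (ExistsIn 2 (inst 4 [0, 1] \<phi>))))))" \<comment> \<open>x y b a\<close>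

definition Subset_Collection :: "fm \<Rightarrow> fm" where
  "Subset_Collection \<psi> = Forall (Forall (Exists (Forall (Impl
     (ForallIn 3 (ExistsIn 3 (inst 6 [1, 0, 2] \<psi>))) \<comment> \<open>y x u c b a\<close>
     (ExistsIn 1 (Conj
        (ForallIn 4 (ExistsIn 1 (inst 7 [1, 0, 3] \<psi>))) \<comment> \<open>y x d u c b a\<close>
        (ForallIn 0 (ExistsIn 5 (inst 7 [0, 1, 3] \<psi>)))))))))" \<comment> \<open>x y d u c b a\<close>

definition CZF :: "fm set" where
  "CZF = univ_closure `
     ({Extensionality, Empty_Set, Pairing, Union_Axiom, Strong_Infinity}
      \<union> range Set_Induction
      \<union> Separation ` {\<phi>. bounded_fm \<phi>}
      \<union> range Strong_Collection
      \<union> range Subset_Collection)"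

definition Foundation :: fm where
  "Foundation = Forall (Impl (Exists (Mem 0 1))
     (ExistsIn 0 (ForallIn 0 (Impl (Mem 0 2) Bot))))" \<comment> \<open>y x a\<close>

definition Power_Set :: fm where
  "Power_Set = Forall (Exists (Forall (Iff (Mem 0 1) (ForallIn 0 (Mem 0 3)))))" \<comment> \<open>z x p a\<close>

definition Infinity :: fm where
  "Infinity = Exists (Conj (ExistsIn 0 (ForallIn 0 Bot))
     (ForallIn 0 (ExistsIn 1 (Forall
        (Iff (Mem 0 1) (Disj (Mem 0 2) (Eql 0 2)))))))" \<comment> \<open>z y x a; y = x \<union> {x}\<close>

definition Replacement :: "fm \<Rightarrow> fm" where
  "Replacement \<phi> = Forall (Impl
     (ForallIn 0 (Forall (Forall (Impl
        (Conj (inst 4 [2, 1] \<phi>) (inst 4 [2, 0] \<phi>)) (Eql 1 0))))) \<comment> \<open>z y x a\<close>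
     (Exists (Forall (Iff (Mem 0 1) (ExistsIn 2 (inst 4 [0, 1] \<phi>))))))" \<comment> \<open>x y b a\<close>

definition ZF :: "fm set" where
  "ZF = univ_closure `
     ({Extensionality, Foundation, Empty_Set, Pairing, Union_Axiom, Power_Set, Infinity}
      \<union> range Separation
      \<union> range Replacement)"


section \<open>Transitive models\<close>

text \<open>The ambient universe of sets is a type \<open>'u\<close> with a membership relation \<open>E\<close> that is
  extensional and well-founded. No further closure of the universe is needed, so none is assumed;
  every actual universe of sets is an instance. Models are subcollections of the universe with the
  restriction of \<open>E\<close>, and may be proper classes.\<close>

definition set_universe :: "('u \<Rightarrow> 'u \<Rightarrow> bool) \<Rightarrow> bool" where
  "set_universe E \<longleftrightarrow> wfP E \<and> (\<forall>a b. (\<forall>x. E x a \<longleftrightarrow> E x b) \<longrightarrow> a = b)"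

text \<open>Classical satisfaction in the structure with domain \<open>M\<close>; the assignment \<open>e\<close> interprets the
  free variable \<open>i\<close> as \<open>e i\<close>.\<close>

primrec sat :: "('u \<Rightarrow> 'u \<Rightarrow> bool) \<Rightarrow> 'u set \<Rightarrow> (nat \<Rightarrow> 'u) \<Rightarrow> fm \<Rightarrow> bool" where
  "sat E M e (Mem i j) \<longleftrightarrow> E (e i) (e j)"
| "sat E M e (Eql i j) \<longleftrightarrow> e i = e j"
| "sat E M e Bot \<longleftrightarrow> False"
| "sat E M e (Conj \<phi> \<psi>) \<longleftrightarrow> sat E M e \<phi> \<and> sat E M e \<psi>"
| "sat E M e (Disj \<phi> \<psi>) \<longleftrightarrow> sat E M e \<phi> \<or> sat E M e \<psi>"
| "sat E M e (Impl \<phi> \<psi>) \<longleftrightarrow> (sat E M e \<phi> \<longrightarrow> sat E M e \<psi>)"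
| "sat E M e (Forall \<phi>) \<longleftrightarrow> (\<forall>a\<in>M. sat E M (case_nat a e) \<phi>)"
| "sat E M e (Exists \<phi>) \<longleftrightarrow> (\<exists>a\<in>M. sat E M (case_nat a e) \<phi>)"

definition transitive_ZF_model :: "('u \<Rightarrow> 'u \<Rightarrow> bool) \<Rightarrow> 'u set \<Rightarrow> bool" where
  "transitive_ZF_model E M \<longleftrightarrow>
     M \<noteq> {} \<and> (\<forall>y\<in>M. \<forall>x. E x y \<longrightarrow> x \<in> M) \<and>
     (\<forall>\<phi>\<in>ZF. \<forall>e. range e \<subseteq> M \<longrightarrow> sat E M e \<phi>)"


section \<open>Kripke models with classical domains\<close>

text \<open>The frame is \<open>K\<close> with \<open>v \<le> w\<close> iff \<open>(v, w) \<in> R\<close>. Preservation of atomic statements follows from the other clauses, as all models carry the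
  restriction of the same relation \<open>E\<close>.\<close>

definition sound_assignment ::
  "('u \<Rightarrow> 'u \<Rightarrow> bool) \<Rightarrow> 'k set \<Rightarrow> ('k \<times> 'k) set \<Rightarrow> ('k \<Rightarrow> 'u set) \<Rightarrow> bool" where
  "sound_assignment E K R M \<longleftrightarrow>
     (\<forall>v\<in>K. transitive_ZF_model E (M v)) \<and>
     (\<forall>(v, w)\<in>R. M v \<subseteq> M w \<and>
        (\<forall>e i j. range e \<subseteq> M v \<longrightarrow>
           (sat E (M v) e (Mem i j) \<longrightarrow> sat E (M w) e (Mem i j)) \<and>
           (sat E (M v) e (Eql i j) \<longrightarrow> sat E (M w) e (Eql i j))))"

definition kripke_model_classical_domains ::
  "('u \<Rightarrow> 'u \<Rightarrow> bool) \<Rightarrow> 'k set \<Rightarrow> ('k \<times> 'k) set \<Rightarrow> ('k \<Rightarrow> 'u set) \<Rightarrow> bool" where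
  "kripke_model_classical_domains E K R M \<longleftrightarrow>
     partial_order_on K R \<and> sound_assignment E K R M"

primrec forces ::
  "('u \<Rightarrow> 'u \<Rightarrow> bool) \<Rightarrow> 'k set \<Rightarrow> ('k \<times> 'k) set \<Rightarrow> ('k \<Rightarrow> 'u set) \<Rightarrow> 'k \<Rightarrow> (nat \<Rightarrow> 'u) \<Rightarrow> fm \<Rightarrow> bool"
where
  "forces E K R M v e (Mem i j) \<longleftrightarrow> E (e i) (e j)"
| "forces E K R M v e (Eql i j) \<longleftrightarrow> e i = e j"
| "forces E K R M v e Bot \<longleftrightarrow> False"
| "forces E K R M v e (Conj \<phi> \<psi>) \<longleftrightarrow> forces E K R M v e \<phi> \<and> forces E K R M v e \<psi>"
| "forces E K R M v e (Disj \<phi> \<psi>) \<longleftrightarrow> forces E K R M v e \<phi> \<or> forces E K R M v e \<psi>"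
| "forces E K R M v e (Impl \<phi> \<psi>) \<longleftrightarrow>
     (\<forall>w\<in>K. (v, w) \<in> R \<longrightarrow> forces E K R M w e \<phi> \<longrightarrow> forces E K R M w e \<psi>)"
| "forces E K R M v e (Forall \<phi>) \<longleftrightarrow>
     (\<forall>w\<in>K. (v, w) \<in> R \<longrightarrow> (\<forall>a\<in>M w. forces E K R M w (case_nat a e) \<phi>))"
| "forces E K R M v e (Exists \<phi>) \<longleftrightarrow> (\<exists>a\<in>M v. forces E K R M v (case_nat a e) \<phi>)"

text \<open>For sentences the assignment is irrelevant.\<close>

definition kripke_valid ::
  "('u \<Rightarrow> 'u \<Rightarrow> bool) \<Rightarrow> 'k set \<Rightarrow> ('k \<times> 'k) set \<Rightarrow> ('k \<Rightarrow> 'u set) \<Rightarrow> fm \<Rightarrow> bool" where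
  "kripke_valid E K R M \<phi> \<longleftrightarrow> (\<forall>v\<in>K. \<forall>e. range e \<subseteq> M v \<longrightarrow> forces E K R M v e \<phi>)"


section \<open>Generic extensions\<close>

definition is_upair :: "('u \<Rightarrow> 'u \<Rightarrow> bool) \<Rightarrow> 'u \<Rightarrow> 'u \<Rightarrow> 'u \<Rightarrow> bool" where
  "is_upair E x y z \<longleftrightarrow> (\<forall>t. E t z \<longleftrightarrow> t = x \<or> t = y)"

text \<open>Kuratowski pairs: \<open>z = {{x, x}, {x, y}}\<close>.\<close>

definition is_opair :: "('u \<Rightarrow> 'u \<Rightarrow> bool) \<Rightarrow> 'u \<Rightarrow> 'u \<Rightarrow> 'u \<Rightarrow> bool" where
  "is_opair E x y z \<longleftrightarrow> (\<exists>s d. is_upair E x x s \<and> is_upair E x y d \<and> is_upair E s d z)"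

definition opair_in :: "('u \<Rightarrow> 'u \<Rightarrow> bool) \<Rightarrow> 'u \<Rightarrow> 'u \<Rightarrow> 'u \<Rightarrow> bool" where
  "opair_in E x y r \<longleftrightarrow> (\<exists>z. is_opair E x y z \<and> E z r)"

text \<open>The set \<open>P\<close>, preordered by the set of pairs \<open>L\<close>; \<open>opair_in E p q L\<close> means that \<open>p\<close> is stronger
  than \<open>q\<close>. Neither antisymmetry nor a largest condition is required.\<close>

definition forcing_notion :: "('u \<Rightarrow> 'u \<Rightarrow> bool) \<Rightarrow> 'u \<Rightarrow> 'u \<Rightarrow> bool" where
  "forcing_notion E P L \<longleftrightarrow>
     (\<forall>p. E p P \<longrightarrow> opair_in E p p L) \<and>
     (\<forall>p q r. E p P \<and> E q P \<and> E r P \<and> opair_in E p q L \<and> opair_in E q r L \<longrightarrow> opair_in E p r L)"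

definition dense_subset :: "('u \<Rightarrow> 'u \<Rightarrow> bool) \<Rightarrow> 'u \<Rightarrow> 'u \<Rightarrow> 'u \<Rightarrow> bool" where
  "dense_subset E P L D \<longleftrightarrow>
     (\<forall>d. E d D \<longrightarrow> E d P) \<and> (\<forall>p. E p P \<longrightarrow> (\<exists>d. E d D \<and> opair_in E d p L))"

definition generic_filter :: "('u \<Rightarrow> 'u \<Rightarrow> bool) \<Rightarrow> 'u set \<Rightarrow> 'u \<Rightarrow> 'u \<Rightarrow> 'u \<Rightarrow> bool" where
  "generic_filter E M P L G \<longleftrightarrow>
     (\<forall>p. E p G \<longrightarrow> E p P) \<and>
     (\<exists>p. E p G) \<and>
     (\<forall>p q. E p G \<and> E q P \<and> opair_in E p q L \<longrightarrow> E q G) \<and>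
     (\<forall>p q. E p G \<and> E q G \<longrightarrow> (\<exists>r. E r G \<and> opair_in E r p L \<and> opair_in E r q L)) \<and>
     (\<forall>D\<in>M. dense_subset E P L D \<longrightarrow> (\<exists>p. E p D \<and> E p G))"

inductive forcing_name :: "('u \<Rightarrow> 'u \<Rightarrow> bool) \<Rightarrow> 'u \<Rightarrow> 'u \<Rightarrow> bool" for E P where
  "(\<And>z. E z \<tau> \<Longrightarrow> \<exists>\<sigma> p. is_opair E \<sigma> p z \<and> E p P \<and> forcing_name E P \<sigma>) \<Longrightarrow> forcing_name E P \<tau>"

text \<open>\<open>N\<close> is \<open>M[G]\<close>: the map \<open>val\<close> is the evaluation of names by recursion,
  \<open>val \<tau> = {val \<sigma> | \<exists>p\<in>G. (\<sigma>, p) \<in> \<tau>}\<close>. If \<open>M\<close> is transitive and the universe is extensional and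
  well-founded, this equation determines \<open>val\<close> on the names in \<open>M\<close>.\<close>

definition generic_extension ::
  "('u \<Rightarrow> 'u \<Rightarrow> bool) \<Rightarrow> 'u set \<Rightarrow> 'u \<Rightarrow> 'u \<Rightarrow> 'u set \<Rightarrow> bool" where
  "generic_extension E M P G N \<longleftrightarrow>
     (\<exists>val. (\<forall>\<tau>\<in>M. forcing_name E P \<tau> \<longrightarrow>
               (\<forall>y. E y (val \<tau>) \<longleftrightarrow> (\<exists>\<sigma> p. E p G \<and> opair_in E \<sigma> p \<tau> \<and> y = val \<sigma>))) \<and>
            N = val ` {\<tau>\<in>M. forcing_name E P \<tau>})"

definition nontrivial_generic_extension ::
  "('u \<Rightarrow> 'u \<Rightarrow> bool) \<Rightarrow> 'u set \<Rightarrow> 'u set \<Rightarrow> bool" where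
  "nontrivial_generic_extension E M N \<longleftrightarrow>
     (\<exists>P\<in>M. \<exists>L\<in>M. \<exists>G. forcing_notion E P L \<and> generic_filter E M P L G \<and> G \<notin> M \<and>
        generic_extension E M P G N)"

end

theory Submission
  imports Defs
begin

text \<open>Let \<open>G \<subseteq> P\<close> be the generic filter with \<open>\<M>\<^sub>w = \<M>\<^sub>v[G]\<close>. Check names, constructed by recursion inside
  \<open>\<M>\<^sub>v\<close>, give a name for \<open>G\<close>, so \<open>G \<in> \<M>\<^sub>w\<close>. Subset Collection at \<open>v\<close> with \<open>a = b = P\<close>
  and \<open>\<psi>(x, y, u) = (y \<in> u \<and> (x \<in> u \<rightarrow> y = x))\<close> yields some \<open>c \<in> \<M>\<^sub>v\<close> that has to serve the parameter
  \<open>u = G\<close> at the later node \<open>w\<close> as well. The hypothesis holds for \<open>u = G\<close>: take \<open>y = x\<close> if \<open>x \<in> G\<close> and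
  a fixed element of \<open>G\<close> otherwise. The only set \<open>d\<close> satisfying the conclusion is \<open>G\<close> itself, so
  \<open>G \<in> c\<close> and hence \<open>G \<in> \<M>\<^sub>v\<close> by transitivity.\<close>

section \<open>Satisfaction under renaming, instantiation and universal closure\<close>

lemma sat_rename: "sat E M e (rename f \<phi>) \<longleftrightarrow> sat E M (\<lambda>i. e (f i)) \<phi>"
proof (induction \<phi> arbitrary: e f)
  case (Forall \<phi>)
  have "(\<lambda>i. case_nat a e (case_nat 0 (\<lambda>i. Suc (f i)) i)) = case_nat a (\<lambda>i. e (f i))" for a
    by (auto split: nat.split)
  then show ?case by (simp add: Forall)
next
  case (Exists \<phi>)
  have "(\<lambda>i. case_nat a e (case_nat 0 (\<lambda>i. Suc (f i)) i)) = case_nat a (\<lambda>i. e (f i))" for a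
    by (auto split: nat.split)
  then show ?case by (simp add: Exists)
qed auto

lemma case_nat_eta: "case_nat (e 0) (\<lambda>i. e (Suc i)) = e"
  by (auto split: nat.split)

text \<open>Instantiating the quantifier with \<open>e 0\<close> under the tail of \<open>e\<close>
  gives back \<open>e\<close>. Since each step passes to a tail, the hypothesis must cover all
  assignments into \<open>M\<close>.\<close>

lemma sat_Forall_funpow:
  assumes "\<And>e. range e \<subseteq> M \<Longrightarrow> sat E M e ((Forall ^^ n) \<phi>)" and "range e \<subseteq> M"
  shows "sat E M e \<phi>"
  using assms
proof (induction n arbitrary: \<phi> e)
  case (Suc n)
  have "sat E M e (Forall \<phi>)" if "range e \<subseteq> M" for e
    using Suc.IH[of "Forall \<phi>" e] Suc.prems(1) that by (simp add: funpow_swap1)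
  from this[of "\<lambda>i. e (Suc i)"] Suc.prems(2) show ?case
    by (auto simp: image_subset_iff case_nat_eta dest!: bspec[of _ _ "e 0"])
qed simp

lemma sat_univ_closure:
  assumes "\<And>e. range e \<subseteq> M \<Longrightarrow> sat E M e (univ_closure \<phi>)" and "range e \<subseteq> M"
  shows "sat E M e \<phi>"
  using assms unfolding univ_closure_def by (rule sat_Forall_funpow)

lemma sat_inst:
  "sat E M e (inst d xs \<phi>) \<longleftrightarrow>
    sat E M (\<lambda>i. if i < length xs then e (xs ! i) else e (i - length xs + d)) \<phi>"
  by (simp add: inst_def sat_rename if_distrib)

section \<open>Definable relations over a transitive model of ZF\<close>

locale transitive_model =
  fixes E :: "'u \<Rightarrow> 'u \<Rightarrow> bool" and M :: "'u set"
  assumes universe: "set_universe E" and model: "transitive_ZF_model E M"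
begin

lemma ext: "(\<And>x. E x a \<longleftrightarrow> E x b) \<Longrightarrow> a = b"
  using universe unfolding set_universe_def by blast

lemma E_induct [case_names step]: "(\<And>x. (\<And>y. E y x \<Longrightarrow> Q y) \<Longrightarrow> Q x) \<Longrightarrow> Q x"
  using universe unfolding set_universe_def by (metis wfp_induct)

lemma trans_M: "E x y \<Longrightarrow> y \<in> M \<Longrightarrow> x \<in> M"
  using model unfolding transitive_ZF_model_def by blast

lemma sat_axiom: "univ_closure \<phi> \<in> ZF \<Longrightarrow> range e \<subseteq> M \<Longrightarrow> sat E M e \<phi>"
  by (rule sat_univ_closure) (use model in \<open>auto simp: transitive_ZF_model_def\<close>)

text \<open>A semantic substitute for writing de Bruijn formulas: closure rules on HOL predicates
  supply the formula that Replacement asks for.\<close>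

definition definable :: "((nat \<Rightarrow> 'u) \<Rightarrow> bool) \<Rightarrow> bool" where
  "definable Q \<longleftrightarrow> (\<exists>\<phi>. \<forall>e. range e \<subseteq> M \<longrightarrow> (sat E M e \<phi> \<longleftrightarrow> Q e))"

lemma definableI: "(\<And>e. range e \<subseteq> M \<Longrightarrow> sat E M e \<phi> \<longleftrightarrow> Q e) \<Longrightarrow> definable Q"
  unfolding definable_def by blast

lemma definable_cong:
  assumes "definable Q" and "\<And>e. range e \<subseteq> M \<Longrightarrow> Q e \<longleftrightarrow> Q' e"
  shows "definable Q'"
  using assms unfolding definable_def by metis

lemma definable_mem: "definable (\<lambda>e. E (e i) (e j))"
  by (rule definableI[of "Mem i j"]) simp

lemma definable_eq: "definable (\<lambda>e. e i = e j)"
  by (rule definableI[of "Eql i j"]) simp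

lemma definable_conj: "definable Q \<Longrightarrow> definable Q' \<Longrightarrow> definable (\<lambda>e. Q e \<and> Q' e)"
  unfolding definable_def by (metis sat.simps(4))

lemma definable_disj: "definable Q \<Longrightarrow> definable Q' \<Longrightarrow> definable (\<lambda>e. Q e \<or> Q' e)"
  unfolding definable_def by (metis sat.simps(5))

lemma definable_imp: "definable Q \<Longrightarrow> definable Q' \<Longrightarrow> definable (\<lambda>e. Q e \<longrightarrow> Q' e)"
  unfolding definable_def by (metis sat.simps(6))

lemma definable_iff:
  assumes "definable Q" and "definable Q'"
  shows "definable (\<lambda>e. Q e \<longleftrightarrow> Q' e)"
  by (rule definable_cong[OF definable_conj[OF definable_imp[OF assms] definable_imp[OF assms(2,1)]]])
    blast

lemma definable_all:
  assumes "definable (\<lambda>e. Q (e 0) (\<lambda>i. e (Suc i)))"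
  shows "definable (\<lambda>e. \<forall>a\<in>M. Q a e)"
proof -
  obtain \<phi> where \<phi>: "\<And>e. range e \<subseteq> M \<Longrightarrow> sat E M e \<phi> \<longleftrightarrow> Q (e 0) (\<lambda>i. e (Suc i))"
    using assms unfolding definable_def by blast
  have "sat E M (case_nat a e) \<phi> \<longleftrightarrow> Q a e" if "range e \<subseteq> M" "a \<in> M" for a e
    using \<phi>[of "case_nat a e"] that by (auto simp: image_subset_iff split: nat.split)
  then show ?thesis
    by (intro definableI[of "Forall \<phi>"]) auto
qed

lemma definable_ex:
  assumes "definable (\<lambda>e. Q (e 0) (\<lambda>i. e (Suc i)))"
  shows "definable (\<lambda>e. \<exists>a\<in>M. Q a e)"
proof -
  obtain \<phi> where \<phi>: "\<And>e. range e \<subseteq> M \<Longrightarrow> sat E M e \<phi> \<longleftrightarrow> Q (e 0) (\<lambda>i. e (Suc i))"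
    using assms unfolding definable_def by blast
  have "sat E M (case_nat a e) \<phi> \<longleftrightarrow> Q a e" if "range e \<subseteq> M" "a \<in> M" for a e
    using \<phi>[of "case_nat a e"] that by (auto simp: image_subset_iff split: nat.split)
  then show ?thesis
    by (intro definableI[of "Exists \<phi>"]) auto
qed

lemmas definable_intros =
  definable_mem definable_eq definable_conj definable_disj definable_imp definable_iff
  definable_all definable_ex

text \<open>Absoluteness: by transitivity the elements of \<open>e k\<close> lie in
  \<open>M\<close>, as do \<open>e i\<close> and \<open>e j\<close>, so the quantifier over the
  universe can be restricted to \<open>M\<close>.\<close>

lemma definable_is_upair: "definable (\<lambda>e. is_upair E (e i) (e j) (e k))"
proof (rule definable_cong)
  show "definable (\<lambda>e. \<forall>t\<in>M. E t (e k) \<longleftrightarrow> t = e i \<or> t = e j)"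
    by (intro definable_intros)
qed (auto simp: is_upair_def image_subset_iff dest: trans_M)

lemma is_opair_components:
  assumes "is_opair E x y z" and "z \<in> M"
  shows "x \<in> M" and "y \<in> M"
proof -
  obtain s d where "E x s" "E s z" "E y d" "E d z"
    using assms(1) unfolding is_opair_def is_upair_def by blast
  then show "x \<in> M" "y \<in> M" using trans_M assms(2) by blast+
qed

lemma definable_is_opair: "definable (\<lambda>e. is_opair E (e i) (e j) (e k))"
proof (rule definable_cong)
  show "definable (\<lambda>e. \<exists>s\<in>M. \<exists>d\<in>M.
      is_upair E (e i) (e i) s \<and> is_upair E (e i) (e j) d \<and> is_upair E s d (e k))"
    by (intro definable_intros definable_is_upair)
next
  fix e :: "nat \<Rightarrow> 'u"
  assume "range e \<subseteq> M"
  then have "e k \<in> M" by blast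
  then have "s \<in> M \<and> d \<in> M" if "is_upair E s d (e k)" for s d
    using that trans_M unfolding is_upair_def by blast
  then show "(\<exists>s\<in>M. \<exists>d\<in>M.
      is_upair E (e i) (e i) s \<and> is_upair E (e i) (e j) d \<and> is_upair E s d (e k)) \<longleftrightarrow>
      is_opair E (e i) (e j) (e k)"
    unfolding is_opair_def by blast
qed

lemma opair_in_components:
  assumes "opair_in E x y r" and "r \<in> M"
  shows "x \<in> M" and "y \<in> M"
  using assms is_opair_components trans_M unfolding opair_in_def by blast+

lemma definable_opair_in: "definable (\<lambda>e. opair_in E (e i) (e j) (e k))"
proof (rule definable_cong)
  show "definable (\<lambda>e. \<exists>z\<in>M. is_opair E (e i) (e j) z \<and> E z (e k))"
    by (intro definable_intros definable_is_opair)
qed (auto simp: opair_in_def image_subset_iff dest: trans_M)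

lemmas definable_rules = definable_intros definable_is_upair definable_is_opair definable_opair_in

section \<open>Pairs, unions and Replacement inside the model\<close>

lemma is_upair_unique: "is_upair E x y z \<Longrightarrow> is_upair E x y z' \<Longrightarrow> z = z'"
  by (rule ext) (simp add: is_upair_def)

lemma is_opair_unique: "is_opair E x y z \<Longrightarrow> is_opair E x y z' \<Longrightarrow> z = z'"
  unfolding is_opair_def by (metis is_upair_unique)

lemma is_opair_inject:
  assumes "is_opair E x y z" and "is_opair E x' y' z"
  shows "x = x' \<and> y = y'"
  using assms unfolding is_opair_def is_upair_def by metis

lemma opair_in_imp_mem: "opair_in E x y r \<Longrightarrow> is_opair E x y z \<Longrightarrow> E z r"
  unfolding opair_in_def using is_opair_unique by blast

lemma ex_upair:
  assumes "x \<in> M" and "y \<in> M"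
  shows "\<exists>z\<in>M. is_upair E x y z"
proof -
  have "sat E M (\<lambda>_. x) Pairing"
    by (rule sat_axiom) (use assms in \<open>auto simp: ZF_def\<close>)
  then have "\<forall>x\<in>M. \<forall>y\<in>M. \<exists>z\<in>M. \<forall>t\<in>M. (E t z \<longrightarrow> t = x \<or> t = y) \<and> (t = x \<or> t = y \<longrightarrow> E t z)"
    by (simp add: Pairing_def Iff_def numeral_eq_Suc)
  then obtain z where "z \<in> M" "\<forall>t\<in>M. E t z \<longleftrightarrow> t = x \<or> t = y"
    using assms by (metis (no_types))
  moreover from this have "E t z \<longleftrightarrow> t = x \<or> t = y" for t
    using assms trans_M[of t z] by blast
  ultimately show ?thesis
    unfolding is_upair_def by blast
qed

lemma ex_opair:
  assumes "x \<in> M" and "y \<in> M"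
  shows "\<exists>z\<in>M. is_opair E x y z"
  unfolding is_opair_def using ex_upair assms by meson

lemma ex_Union:
  assumes "a \<in> M"
  shows "\<exists>b\<in>M. \<forall>x. E x b \<longleftrightarrow> (\<exists>y. E y a \<and> E x y)"
proof -
  have "sat E M (\<lambda>_. a) Union_Axiom"
    by (rule sat_axiom) (use assms in \<open>auto simp: ZF_def\<close>)
  then have "\<forall>a\<in>M. \<exists>b\<in>M. \<forall>x\<in>M. (E x b \<longrightarrow> (\<exists>y\<in>M. E y a \<and> E x y)) \<and>
      ((\<exists>y\<in>M. E y a \<and> E x y) \<longrightarrow> E x b)"
    by (simp add: Union_Axiom_def Iff_def ExistsIn_def numeral_eq_Suc)
  then obtain b where b: "b \<in> M" "\<forall>x\<in>M. E x b \<longleftrightarrow> (\<exists>y\<in>M. E y a \<and> E x y)"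
    using assms by (metis (no_types))
  have "E x b \<longleftrightarrow> (\<exists>y. E y a \<and> E x y)" for x
  proof
    show "E x b \<Longrightarrow> \<exists>y. E y a \<and> E x y" using b trans_M by blast
  next
    assume "\<exists>y. E y a \<and> E x y"
    then obtain y where y: "E y a" "E x y" by blast
    then have "y \<in> M" using assms trans_M by blast
    then show "E x b" using b y trans_M by blast
  qed
  then show ?thesis
    using b(1) by blast
qed

lemma ex_insert:
  assumes "a \<in> M" and "c \<in> M"
  shows "\<exists>b\<in>M. \<forall>x. E x b \<longleftrightarrow> E x a \<or> x = c"
proof -
  \<comment> \<open>The set \<open>a \<union> {c}\<close> is obtained as the union of the pair
    \<open>{a, {c}}\<close>.\<close>
  obtain s where s: "s \<in> M" "is_upair E c c s" using ex_upair assms by blast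
  obtain t where t: "t \<in> M" "is_upair E a s t" using ex_upair assms s by blast
  obtain b where "b \<in> M" "\<forall>x. E x b \<longleftrightarrow> (\<exists>y. E y t \<and> E x y)" using ex_Union t by blast
  then show ?thesis using s t unfolding is_upair_def by auto
qed

text \<open>Two parameter slots cover every later application. Transitivity turns the image inside
  \<open>M\<close> into a description of all elements of \<open>b\<close> in the universe.\<close>

lemma ex_replacement:
  assumes Q: "definable (\<lambda>e. Q (e 0) (e 1) (e 2) (e 3))"
    and "a \<in> M" and "c \<in> M" and "d \<in> M"
    and single: "\<And>x y z. \<lbrakk>E x a; y \<in> M; z \<in> M; Q x y c d; Q x z c d\<rbrakk> \<Longrightarrow> y = z"
  shows "\<exists>b\<in>M. \<forall>y. E y b \<longleftrightarrow> y \<in> M \<and> (\<exists>x. E x a \<and> Q x y c d)"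
proof -
  obtain \<phi> where \<phi>: "\<And>e. range e \<subseteq> M \<Longrightarrow> sat E M e \<phi> \<longleftrightarrow> Q (e 0) (e 1) (e 2) (e 3)"
    using Q unfolding definable_def by blast
  \<comment> \<open>\<open>inst 4\<close> sends the parameter indices 2 and 3 of
    \<open>\<phi>\<close> past the four quantifiers of the axiom, to the first two entries of
    \<open>e\<close>.\<close>
  define e where "e = case_nat c (\<lambda>_::nat. d)"
  have e: "range e \<subseteq> M" and e01: "e 0 = c" "e (Suc 0) = d"
    using assms(3,4) by (auto simp: e_def split: nat.split)
  have ax: "sat E M e (Replacement \<phi>)"
    by (rule sat_axiom) (use e in \<open>auto simp: ZF_def\<close>)
  have "range (case_nat x1 (case_nat x2 (case_nat x3 (case_nat a e)))) \<subseteq> M"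
    if "x1 \<in> M" "x2 \<in> M" "x3 \<in> M" for x1 x2 x3
    using that assms(2) e by (auto simp: image_subset_iff split: nat.split)
  note env = this[unfolded image_subset_iff]
  have inst: "sat E M (case_nat x1 (case_nat x2 (case_nat x3 (case_nat a e)))) (inst 4 [i, j] \<phi>) \<longleftrightarrow>
      Q (case_nat x1 (case_nat x2 (case_nat x3 (\<lambda>_. a))) i)
        (case_nat x1 (case_nat x2 (case_nat x3 (\<lambda>_. a))) j) c d"
    if "x1 \<in> M" "x2 \<in> M" "x3 \<in> M" "i < 4" "j < 4" for x1 x2 x3 i j
    using that env[OF that(1-3)]
    by (subst sat_inst, subst \<phi>)
      (auto simp: image_subset_iff e01 numeral_eq_Suc less_Suc_eq split: nat.splits)
  have "\<exists>b\<in>M. \<forall>y\<in>M. E y b \<longleftrightarrow> (\<exists>x\<in>M. E x a \<and> Q x y c d)"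
  proof -
    have prem: "\<forall>x\<in>M. E x a \<longrightarrow> (\<forall>y\<in>M. \<forall>z\<in>M.
        sat E M (case_nat z (case_nat y (case_nat x (case_nat a e))))
          (Conj (inst 4 [2, 1] \<phi>) (inst 4 [2, 0] \<phi>)) \<longrightarrow> y = z)"
      using single by (auto simp: inst numeral_eq_Suc[of "num.Bit0 num.One"])
    have "\<exists>b\<in>M. \<forall>y\<in>M. E y b \<longleftrightarrow> (\<exists>x\<in>M. E x a \<and>
        sat E M (case_nat x (case_nat y (case_nat b (case_nat a e)))) (inst 4 [0, 1] \<phi>))"
      using ax[unfolded Replacement_def, simplified, rule_format, OF assms(2)] prem
      by (simp add: Iff_def ForallIn_def ExistsIn_def numeral_eq_Suc[of "num.Bit0 num.One"]
          numeral_eq_Suc[of "num.Bit1 num.One"]) blast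
    then show ?thesis by (simp add: inst cong: bex_cong)
  qed
  then show ?thesis
    using assms(2) trans_M by meson
qed

section \<open>Check names by recursion inside the model\<close>

text \<open>An attempt is a set of pairs \<open>(x, n)\<close>, where \<open>n = {(m, p) | y \<in> x}\<close> with \<open>(y, m)\<close> in the attempt
  is the check name of \<open>x\<close>; using one fixed condition \<open>p\<close> of the filter replaces a largest condition.
  Other elements of the set are ignored. Replacement needs a function, so the recursion
  collects the least attempt at each \<open>y \<in> x\<close> instead of choosing one.\<close>

definition attempt :: "'u \<Rightarrow> 'u \<Rightarrow> bool" where
  "attempt p S \<longleftrightarrow> (\<forall>x\<in>M. \<forall>n\<in>M. opair_in E x n S \<longrightarrow>
     (\<forall>y\<in>M. E y x \<longrightarrow> (\<exists>m\<in>M. opair_in E y m S)) \<and>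
     (\<forall>z\<in>M. E z n \<longleftrightarrow> (\<exists>y\<in>M. \<exists>m\<in>M. E y x \<and> opair_in E y m S \<and> is_opair E m p z)))"

definition least_attempt :: "'u \<Rightarrow> 'u \<Rightarrow> 'u \<Rightarrow> bool" where
  "least_attempt p x S \<longleftrightarrow> attempt p S \<and> (\<exists>n\<in>M. opair_in E x n S) \<and>
     (\<forall>S'\<in>M. attempt p S' \<and> (\<exists>n\<in>M. opair_in E x n S') \<longrightarrow> (\<forall>t\<in>M. E t S \<longrightarrow> E t S'))"

text \<open>Both definitions quantify only over \<open>M\<close>, so the closure rules apply
  directly; this makes the recursion accessible to Replacement.\<close>

lemma definable_least_attempt: "definable (\<lambda>e. least_attempt (e i) (e j) (e k))"
  unfolding least_attempt_def attempt_def by (intro definable_rules)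

lemma attempt_total:
  assumes "attempt p S" and "S \<in> M" and "opair_in E x n S" and "E y x"
  shows "\<exists>m. opair_in E y m S"
proof -
  have "x \<in> M" "n \<in> M" using opair_in_components[OF assms(3,2)] by auto
  moreover have "y \<in> M" using trans_M[OF assms(4)] calculation by blast
  ultimately show ?thesis using assms(1,3,4) unfolding attempt_def by blast
qed

lemma attempt_value:
  assumes "attempt p S" and "S \<in> M" and "opair_in E x n S"
  shows "E z n \<longleftrightarrow> z \<in> M \<and> (\<exists>y m. E y x \<and> opair_in E y m S \<and> is_opair E m p z)"
proof -
  have x: "x \<in> M" and n: "n \<in> M" using opair_in_components[OF assms(3,2)] by auto
  have "\<forall>z\<in>M. E z n \<longleftrightarrow> (\<exists>y\<in>M. \<exists>m\<in>M. E y x \<and> opair_in E y m S \<and> is_opair E m p z)"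
    using assms(1,3) x n unfolding attempt_def by blast
  moreover have "E z n \<Longrightarrow> z \<in> M" using trans_M n by blast
  ultimately show ?thesis
    using opair_in_components[OF _ assms(2)] by blast
qed

lemma attemptI:
  assumes "\<And>x n y. \<lbrakk>opair_in E x n S; E y x\<rbrakk> \<Longrightarrow> \<exists>m. opair_in E y m S"
    and "\<And>x n z. \<lbrakk>opair_in E x n S; z \<in> M\<rbrakk> \<Longrightarrow>
      E z n \<longleftrightarrow> (\<exists>y m. E y x \<and> opair_in E y m S \<and> is_opair E m p z)"
    and "S \<in> M"
  shows "attempt p S"
  unfolding attempt_def
proof (intro ballI impI conjI)
  fix x n y assume "opair_in E x n S" "E y x"
  then show "\<exists>m\<in>M. opair_in E y m S"
    using assms(1) opair_in_components[OF _ assms(3)] by blast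
next
  fix x n z assume "opair_in E x n S" "z \<in> M"
  from assms(2)[OF this]
  show "E z n \<longleftrightarrow> (\<exists>y\<in>M. \<exists>m\<in>M. E y x \<and> opair_in E y m S \<and> is_opair E m p z)"
    using opair_in_components[OF _ assms(3)] by blast
qed

text \<open>By totality both sets have pairs at every element of \<open>x\<close>, by induction
  along \<open>E\<close> the same ones; the recursion equation then gives \<open>n\<close> and
  \<open>n'\<close> the same elements.\<close>

lemma attempt_unique:
  assumes "attempt p S" "S \<in> M" "attempt p S'" "S' \<in> M"
  shows "opair_in E x n S \<Longrightarrow> opair_in E x n' S' \<Longrightarrow> n = n'"
proof (induction x arbitrary: n n' rule: E_induct)
  case (step x)
  have "opair_in E y m S \<longleftrightarrow> opair_in E y m S'" if "E y x" for y m
    using step that attempt_total assms by metis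
  then show ?case
    using attempt_value[OF assms(1,2) step.prems(1)] attempt_value[OF assms(3,4) step.prems(2)]
    by (intro ext) blast
qed

lemma least_attempt_unique:
  assumes "least_attempt p x S" "S \<in> M" "least_attempt p x S'" "S' \<in> M"
  shows "S = S'"
  using assms trans_M unfolding least_attempt_def by (intro ext) blast

text \<open>Induction along \<open>E\<close>: unite the least attempts at the elements of
  \<open>x\<close> into \<open>U\<close>, then add the pair of \<open>x\<close> and the name
  \<open>n\<close> computed from \<open>U\<close>.\<close>

lemma ex_least_attempt:
  assumes p: "p \<in> M"
  shows "x \<in> M \<Longrightarrow> \<exists>S\<in>M. least_attempt p x S"
proof (induction x rule: E_induct)
  case (step x)
  \<comment> \<open>Leastness makes the attempt at each \<open>y\<close> unique, so this relation is
    functional and Replacement applies.\<close>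
  have "\<exists>F\<in>M. \<forall>s. E s F \<longleftrightarrow> s \<in> M \<and> (\<exists>y. E y x \<and> least_attempt p y s)"
  proof (rule ex_replacement[where Q = "\<lambda>y s p _. least_attempt p y s"])
    show "definable (\<lambda>e. least_attempt (e 2) (e 0) (e 1))"
      by (rule definable_least_attempt)
  qed (use step.prems p least_attempt_unique in blast)+
  then obtain F where F: "F \<in> M"
    "\<And>s. E s F \<longleftrightarrow> s \<in> M \<and> (\<exists>y. E y x \<and> least_attempt p y s)" by blast
  obtain U where U: "U \<in> M" "\<And>t. E t U \<longleftrightarrow> (\<exists>s. E s F \<and> E t s)"
    using ex_Union[OF F(1)] by blast
  have U_dest: "\<exists>s\<in>M. attempt p s \<and> opair_in E y m s \<and> (\<forall>t. E t s \<longrightarrow> E t U)"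
    if "opair_in E y m U" for y m
    using that U F unfolding opair_in_def least_attempt_def by blast
  have mono: "opair_in E y m s \<Longrightarrow> (\<forall>t. E t s \<longrightarrow> E t U) \<Longrightarrow> opair_in E y m U" for y m s
    unfolding opair_in_def by blast
  have U_dom: "\<exists>m. opair_in E y m U" if y: "E y x" for y
  proof -
    obtain s where s: "s \<in> M" "least_attempt p y s"
      using step y trans_M by blast
    then have "\<forall>t. E t s \<longrightarrow> E t U" using U F y by blast
    then show ?thesis using s mono unfolding least_attempt_def by blast
  qed
  have U_att: "attempt p U"
  proof (rule attemptI[OF _ _ U(1)])
    fix y n u assume "opair_in E y n U" "E u y"
    then show "\<exists>m. opair_in E u m U"
      using U_dest attempt_total mono by meson
  next
    fix y n z assume yn: "opair_in E y n U" and z: "z \<in> M"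
    obtain s where s: "s \<in> M" "attempt p s" "opair_in E y n s" "\<forall>t. E t s \<longrightarrow> E t U"
      using U_dest[OF yn] by blast
    \<comment> \<open>By totality \<open>s\<close> has a pair at \<open>u\<close>; any pair of
      \<open>U\<close> at \<open>u\<close> comes from some attempt, and uniqueness identifies the
      two.\<close>
    have "opair_in E u m s \<longleftrightarrow> opair_in E u m U" if "E u y" for u m
      using that s U_dest mono attempt_total attempt_unique by metis
    then show "E z n \<longleftrightarrow> (\<exists>u m. E u y \<and> opair_in E u m U \<and> is_opair E m p z)"
      using attempt_value[OF s(2,1,3)] z by blast
  qed
  \<comment> \<open>Replacement runs over the pairs in \<open>U\<close>, not over \<open>x\<close>:
    a pair \<open>t = (y, m)\<close> with \<open>y \<in> x\<close> determines \<open>(m, p)\<close>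
    by injectivity of pairing.\<close>
  have "\<exists>n\<in>M. \<forall>z. E z n \<longleftrightarrow> z \<in> M \<and>
      (\<exists>t. E t U \<and> (\<exists>y\<in>M. \<exists>m\<in>M. E y x \<and> is_opair E y m t \<and> is_opair E m p z))"
  proof (rule ex_replacement[where
        Q = "\<lambda>t z x p. \<exists>y\<in>M. \<exists>m\<in>M. E y x \<and> is_opair E y m t \<and> is_opair E m p z"])
    show "definable (\<lambda>e. \<exists>y\<in>M. \<exists>m\<in>M.
        E y (e 2) \<and> is_opair E y m (e 0) \<and> is_opair E m (e 3) (e 1))"
      by (intro definable_rules)
    fix t z z'
    assume "\<exists>y\<in>M. \<exists>m\<in>M. E y x \<and> is_opair E y m t \<and> is_opair E m p z"
      and "\<exists>y\<in>M. \<exists>m\<in>M. E y x \<and> is_opair E y m t \<and> is_opair E m p z'"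
    then show "z = z'"
      using is_opair_inject is_opair_unique by blast
  qed (use step.prems p U in blast)+
  then obtain n where n: "n \<in> M" and n_iff0: "\<And>z. E z n \<longleftrightarrow> z \<in> M \<and>
      (\<exists>t. E t U \<and> (\<exists>y\<in>M. \<exists>m\<in>M. E y x \<and> is_opair E y m t \<and> is_opair E m p z))"
    by blast
  have n_iff: "E z n \<longleftrightarrow> z \<in> M \<and> (\<exists>y m. E y x \<and> opair_in E y m U \<and> is_opair E m p z)" for z
  proof -
    have "(\<exists>t. E t U \<and> (\<exists>y\<in>M. \<exists>m\<in>M. E y x \<and> is_opair E y m t \<and> is_opair E m p z)) \<longleftrightarrow>
        (\<exists>y\<in>M. \<exists>m\<in>M. E y x \<and> opair_in E y m U \<and> is_opair E m p z)"
      unfolding opair_in_def by blast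
    then show ?thesis
      unfolding n_iff0 using opair_in_components[OF _ U(1)] by blast
  qed
  \<comment> \<open>Should \<open>U\<close> already contain a pair at \<open>x\<close>, the
    recursion equation forces its second component to be \<open>n\<close>, so adding
    \<open>(x, n)\<close> causes no conflict.\<close>
  have U_x: "m = n" if "opair_in E x m U" for m
    by (rule ext) (simp only: attempt_value[OF U_att U(1) that] n_iff)
  obtain q where q: "q \<in> M" "is_opair E x n q"
    using ex_opair step.prems n by blast
  obtain S where S: "S \<in> M" "\<And>t. E t S \<longleftrightarrow> E t U \<or> t = q"
    using ex_insert[OF U(1) q(1)] by blast
  have S_iff: "opair_in E y m S \<longleftrightarrow> opair_in E y m U \<or> y = x \<and> m = n" for y m
    unfolding opair_in_def S(2) using q(2) is_opair_inject[OF q(2), of y m] by blast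
  have S_att: "attempt p S"
  proof (rule attemptI[OF _ _ S(1)])
    fix y m u assume "opair_in E y m S" "E u y"
    then show "\<exists>m. opair_in E u m S"
      using S_iff U_dom attempt_total[OF U_att U(1)] by blast
  next
    fix y m z assume ym: "opair_in E y m S" and z: "z \<in> M"
    \<comment> \<open>Nothing new is added below \<open>y\<close>: \<open>U\<close> has a pair at
      \<open>u\<close>, and if \<open>u = x\<close> that pair is already
      \<open>(x, n)\<close>.\<close>
    have eq: "opair_in E u k S \<longleftrightarrow> opair_in E u k U" if "E u y" for u k
    proof -
      have "\<exists>m'. opair_in E u m' U"
        using that ym U_dom attempt_total[OF U_att U(1), of y m u] unfolding S_iff by blast
      then show ?thesis using U_x S_iff by blast
    qed
    have "E z m \<longleftrightarrow> (\<exists>u k. E u y \<and> opair_in E u k U \<and> is_opair E k p z)"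
    proof (cases "opair_in E y m U")
      case True
      then show ?thesis using attempt_value[OF U_att U(1) True, of z] z by simp
    next
      case False
      then have "y = x" "m = n" using ym S_iff by blast+
      then show ?thesis using n_iff z by simp
    qed
    then show "E z m \<longleftrightarrow> (\<exists>u k. E u y \<and> opair_in E u k S \<and> is_opair E k p z)"
      using eq by blast
  qed
  \<comment> \<open>Elements of \<open>U\<close> come from least attempts at some
    \<open>y \<in> x\<close>, where \<open>S'\<close> also has a pair; the added \<open>q\<close>
    lies in \<open>S'\<close> because attempts agree at \<open>x\<close>.\<close>
  have "E t S'" if S': "S' \<in> M" "attempt p S'" and k: "opair_in E x k S'" and t: "E t S" for S' k t
  proof (cases "E t U")
    case True
    then obtain s y where s: "s \<in> M" "E y x" "least_attempt p y s" "E t s"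
      using U F by blast
    moreover obtain m where "opair_in E y m S'"
      using attempt_total[OF S'(2,1) k s(2)] by blast
    ultimately show ?thesis
      using S' opair_in_components trans_M unfolding least_attempt_def by blast
  next
    case False
    then have "t = q" using t S by blast
    moreover have "k = n"
      using attempt_unique[OF S'(2,1) S_att S(1) k] S_iff by blast
    ultimately show ?thesis using opair_in_imp_mem k q(2) by blast
  qed
  then have "least_attempt p x S"
    using S_att S_iff n unfolding least_attempt_def by blast
  then show ?case using S(1) by blast
qed

lemma attempt_forcing_name:
  assumes S: "attempt p S" "S \<in> M" and p: "E p P"
  shows "opair_in E x n S \<Longrightarrow> forcing_name E P n"
proof (induction x arbitrary: n rule: E_induct)
  case (step x)
  show ?case
    using step attempt_value[OF S step.prems] p by (intro forcing_name.intros) blast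
qed

end

section \<open>The generic filter as an element of its extension\<close>

text \<open>Check names built with \<open>p\<close> evaluate to the sets they name because
  \<open>p \<in> G\<close>; pairing the check name of each condition with that condition gives the
  canonical name \<open>\<Gamma>\<close> of \<open>G\<close>.\<close>

lemma generic_extension_contains_filter:
  assumes "set_universe E" and "transitive_ZF_model E M"
    and P: "P \<in> M" and GP: "\<And>p. E p G \<Longrightarrow> E p P" and p: "E p G"
    and "generic_extension E M P G N"
  shows "G \<in> N"
proof -
  interpret transitive_model E M
    using assms(1,2) by unfold_locales
  obtain val where
    val: "\<And>\<tau> y. \<lbrakk>\<tau> \<in> M; forcing_name E P \<tau>\<rbrakk> \<Longrightarrow>
      E y (val \<tau>) \<longleftrightarrow> (\<exists>\<sigma> p. E p G \<and> opair_in E \<sigma> p \<tau> \<and> y = val \<sigma>)"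
    and N: "N = val ` {\<tau>\<in>M. forcing_name E P \<tau>}"
    using assms(6) unfolding generic_extension_def by blast
  have pM: "p \<in> M" using p GP P trans_M by blast
  \<comment> \<open>By totality, an attempt with a pair at \<open>P\<close> has one at every
    condition as well.\<close>
  obtain S where S: "S \<in> M" "attempt p S" "\<exists>n. opair_in E P n S"
    using ex_least_attempt[OF pM P] unfolding least_attempt_def by blast
  have val_check: "val n = x" if "opair_in E x n S" for x n
    using that
  proof (induction x arbitrary: n rule: E_induct)
    case (step x)
    have nM: "n \<in> M" using opair_in_components[OF step.prems S(1)] by blast
    have name: "forcing_name E P n"
      using attempt_forcing_name[OF S(2,1) GP[OF p] step.prems] .
    note n_elem = attempt_value[OF S(2,1) step.prems]
    have name_pairs: "opair_in E m q n \<longleftrightarrow> q = p \<and> (\<exists>y. E y x \<and> opair_in E y m S)" for m q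
    proof
      show "opair_in E m q n \<Longrightarrow> q = p \<and> (\<exists>y. E y x \<and> opair_in E y m S)"
        unfolding opair_in_def[of E m q n] n_elem using is_opair_inject by blast
    next
      assume "q = p \<and> (\<exists>y. E y x \<and> opair_in E y m S)"
      then show "opair_in E m q n"
        unfolding opair_in_def[of E m q n] n_elem
        using ex_opair pM opair_in_components[OF _ S(1)] by blast
    qed
    show ?case
    proof (rule ext)
      fix y
      \<comment> \<open>The only condition occurring in \<open>n\<close> is \<open>p\<close>, and it
        lies in \<open>G\<close>, so every name listed in \<open>n\<close> contributes its
        value.\<close>
      have "E y (val n) \<longleftrightarrow> (\<exists>u m. E u x \<and> opair_in E u m S \<and> y = val m)"
        unfolding val[OF nM name] name_pairs using p by blast
      also have "\<dots> \<longleftrightarrow> (\<exists>u m. E u x \<and> opair_in E u m S \<and> y = u)"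
        using step.IH by (intro ex_cong1) blast
      also have "\<dots> \<longleftrightarrow> E y x"
        using attempt_total[OF S(2,1) step.prems] by blast
      finally show "E y (val n) \<longleftrightarrow> E y x" .
    qed
  qed
  have "\<exists>\<Gamma>\<in>M. \<forall>z. E z \<Gamma> \<longleftrightarrow> z \<in> M \<and>
      (\<exists>q. E q P \<and> (\<exists>m\<in>M. opair_in E q m S \<and> is_opair E m q z))"
  proof (rule ex_replacement[where
        Q = "\<lambda>q z S _. \<exists>m\<in>M. opair_in E q m S \<and> is_opair E m q z"])
    show "definable (\<lambda>e. \<exists>m\<in>M. opair_in E (e 0) m (e 2) \<and> is_opair E m (e 0) (e 1))"
      by (intro definable_rules)
    fix q z z'
    assume "\<exists>m\<in>M. opair_in E q m S \<and> is_opair E m q z"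
      and "\<exists>m\<in>M. opair_in E q m S \<and> is_opair E m q z'"
    then show "z = z'"
      using attempt_unique[OF S(2,1) S(2,1)] is_opair_unique by blast
  qed (use P S in blast)+
  then obtain \<Gamma> where \<Gamma>: "\<Gamma> \<in> M" "\<And>z. E z \<Gamma> \<longleftrightarrow> z \<in> M \<and>
      (\<exists>q. E q P \<and> (\<exists>m\<in>M. opair_in E q m S \<and> is_opair E m q z))"
    by blast
  have name: "forcing_name E P \<Gamma>"
    using \<Gamma>(2) attempt_forcing_name[OF S(2,1) GP[OF p]] by (intro forcing_name.intros) blast
  have name_pairs: "opair_in E m q \<Gamma> \<longleftrightarrow> E q P \<and> opair_in E q m S" for m q
  proof
    show "opair_in E m q \<Gamma> \<Longrightarrow> E q P \<and> opair_in E q m S"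
      unfolding opair_in_def[of E m q \<Gamma>] \<Gamma>(2) using is_opair_inject by blast
  next
    assume "E q P \<and> opair_in E q m S"
    then show "opair_in E m q \<Gamma>"
      unfolding opair_in_def[of E m q \<Gamma>] \<Gamma>(2)
      using ex_opair opair_in_components[OF _ S(1)] by meson
  qed
  have "val \<Gamma> = G"
  proof (rule ext)
    fix y
    \<comment> \<open>A pair \<open>(m, q)\<close> of \<open>\<Gamma>\<close> contributes exactly
      when \<open>q \<in> G\<close>, and then its value is \<open>val m = q\<close>.\<close>
    have "E y (val \<Gamma>) \<longleftrightarrow> (\<exists>q m. E q G \<and> opair_in E q m S \<and> y = val m)"
      unfolding val[OF \<Gamma>(1) name] name_pairs using GP by blast
    also have "\<dots> \<longleftrightarrow> (\<exists>q m. E q G \<and> opair_in E q m S \<and> y = q)"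
      using val_check by (intro ex_cong1) blast
    also have "\<dots> \<longleftrightarrow> E y G"
      using GP S(3) attempt_total[OF S(2,1)] by blast
    finally show "E y (val \<Gamma>) \<longleftrightarrow> E y G" .
  qed
  then show ?thesis using N \<Gamma>(1) name by blast
qed

section \<open>Subset Collection in the Kripke model\<close>

lemma forces_Subset_Collection_subset:
  assumes universe: "set_universe E"
    and kripke: "kripke_model_classical_domains E K R M"
    and valid: "kripke_valid E K R M
      (Subset_Collection (Conj (Mem 1 2) (Impl (Mem 0 2) (Eql 1 0))))"
    and v: "v \<in> K" and w: "w \<in> K" and vw: "(v, w) \<in> R"
    and P: "P \<in> M v" and G: "G \<in> M w" and GP: "\<And>p. E p G \<Longrightarrow> E p P" and p: "E p G"
  shows "G \<in> M v"
proof -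
  have refl: "u \<in> K \<Longrightarrow> (u, u) \<in> R" for u
    using kripke unfolding kripke_model_classical_domains_def partial_order_on_def preorder_on_def
    by (meson refl_onD)
  have trans_M: "E x y \<Longrightarrow> y \<in> M u \<Longrightarrow> u \<in> K \<Longrightarrow> x \<in> M u" for x y u
    using kripke unfolding kripke_model_classical_domains_def sound_assignment_def
      transitive_ZF_model_def by blast
  have mono: "M u \<subseteq> M u'" if "(u, u') \<in> R" for u u'
    using kripke that unfolding kripke_model_classical_domains_def sound_assignment_def by blast
  \<comment> \<open>Index 0 is \<open>x\<close>, index 1 is \<open>y\<close> and index 2 is
    \<open>u\<close>.\<close>
  let ?\<psi> = "Conj (Mem 1 2) (Impl (Mem 0 2) (Eql 1 0))"
  have inst:
    "inst 6 [1, 0, 2] ?\<psi> = Conj (Mem 0 2) (Impl (Mem 1 2) (Eql 0 1))"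
    "inst 7 [1, 0, 3] ?\<psi> = Conj (Mem 0 3) (Impl (Mem 1 3) (Eql 0 1))"
    "inst 7 [0, 1, 3] ?\<psi> = Conj (Mem 1 3) (Impl (Mem 0 3) (Eql 1 0))"
    by (simp_all add: inst_def)
  have "forces E K R M v (\<lambda>_. P) (Subset_Collection ?\<psi>)"
    using valid v P unfolding kripke_valid_def by auto
  \<comment> \<open>The quantifier over \<open>c\<close> is evaluated at \<open>v\<close>, outside
    the one over \<open>u\<close>, so a single \<open>c \<in> M v\<close> serves sets
    \<open>u\<close> that appear only at later nodes.\<close>
  then have "\<exists>c\<in>M v. \<forall>w\<in>K. (v, w) \<in> R \<longrightarrow> (\<forall>u\<in>M w. forces E K R M w
      (case_nat u (case_nat c (case_nat P (case_nat P (\<lambda>_. P)))))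
      (Impl (ForallIn 3 (ExistsIn 3 (inst 6 [1, 0, 2] ?\<psi>)))
        (ExistsIn 1 (Conj
          (ForallIn 4 (ExistsIn 1 (inst 7 [1, 0, 3] ?\<psi>)))
          (ForallIn 0 (ExistsIn 5 (inst 7 [0, 1, 3] ?\<psi>)))))))"
    using v refl[OF v] P unfolding Subset_Collection_def forces.simps(7,8) by blast
  then obtain c where c: "c \<in> M v" and "forces E K R M w
      (case_nat G (case_nat c (case_nat P (case_nat P (\<lambda>_. P)))))
      (Impl (ForallIn 3 (ExistsIn 3 (inst 6 [1, 0, 2] ?\<psi>)))
        (ExistsIn 1 (Conj
          (ForallIn 4 (ExistsIn 1 (inst 7 [1, 0, 3] ?\<psi>)))
          (ForallIn 0 (ExistsIn 5 (inst 7 [0, 1, 3] ?\<psi>))))))"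
    using w vw G by blast
  moreover have "forces E K R M w (case_nat G (case_nat c (case_nat P (case_nat P (\<lambda>_. P)))))
      (ForallIn 3 (ExistsIn 3 (inst 6 [1, 0, 2] ?\<psi>)))"
  proof -
    \<comment> \<open>The witness is \<open>x\<close> if \<open>x \<in> G\<close> and
      \<open>p\<close> otherwise; both lie in \<open>P\<close>, hence in \<open>M w'\<close>.
      Forcing of atoms does not depend on the node, so the forced implication reduces to the
      classical one.\<close>
    have "\<exists>y\<in>M w'. E y P \<and> E y G \<and> (E x G \<longrightarrow> y = x)"
      if "(w, w') \<in> R" "w' \<in> K" "E x P" for w' x
    proof -
      have "P \<in> M w'" using P mono vw that by blast
      then show ?thesis using GP p that trans_M[of _ P w'] by blast
    qed
    \<comment> \<open>The quantifier and the implication in \<open>ForallIn\<close> each move to a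
      later node; transitivity places the second one above \<open>w\<close>.\<close>
    moreover have "(w, w'') \<in> R" if "(w, w') \<in> R" "(w', w'') \<in> R" for w' w''
      using kripke that unfolding kripke_model_classical_domains_def partial_order_on_def preorder_on_def
      by (meson transD)
    ultimately show ?thesis
      unfolding inst ForallIn_def ExistsIn_def
      by (simp add: numeral_eq_Suc) meson
  qed
  ultimately have "forces E K R M w (case_nat G (case_nat c (case_nat P (case_nat P (\<lambda>_. P)))))
      (ExistsIn 1 (Conj
          (ForallIn 4 (ExistsIn 1 (inst 7 [1, 0, 3] ?\<psi>)))
          (ForallIn 0 (ExistsIn 5 (inst 7 [0, 1, 3] ?\<psi>)))))"
    using w refl[OF w] unfolding forces.simps(6) by blast
  then obtain d where d: "E d c"
    and total: "\<forall>w'\<in>K. (w, w') \<in> R \<longrightarrow> (\<forall>x\<in>M w'. \<forall>w''\<in>K. (w', w'') \<in> R \<longrightarrow> E x P \<longrightarrow>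
      (\<exists>y\<in>M w''. E y d \<and> E y G \<and> (\<forall>u\<in>K. (w'', u) \<in> R \<longrightarrow> E x G \<longrightarrow> y = x)))"
    and onto: "\<forall>w'\<in>K. (w, w') \<in> R \<longrightarrow> (\<forall>y\<in>M w'. \<forall>w''\<in>K. (w', w'') \<in> R \<longrightarrow> E y d \<longrightarrow>
      (\<exists>x\<in>M w''. E x P \<and> E y G \<and> (\<forall>u\<in>K. (w'', u) \<in> R \<longrightarrow> E x G \<longrightarrow> y = x)))"
    unfolding inst ForallIn_def ExistsIn_def
    by (auto simp: numeral_eq_Suc)
  \<comment> \<open>Although \<open>d\<close> is found at \<open>w\<close>, it is an element of
    \<open>c\<close>, which belongs to the earlier model.\<close>
  have dM: "d \<in> M v" using d c v trans_M by blast
  \<comment> \<open>With all nodes equal to \<open>w\<close>, \<open>onto\<close> puts every element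
    of \<open>d\<close> into \<open>G\<close>; for \<open>x \<in> G\<close> the witness from
    \<open>total\<close> must be \<open>x\<close> itself, so \<open>x \<in> d\<close>.\<close>
  have "E x d \<longleftrightarrow> E x G" for x
  proof
    assume x: "E x d"
    then have "x \<in> M w" using dM mono[OF vw] trans_M[OF _ _ w] by blast
    then show "E x G" using onto[rule_format, OF w refl[OF w] _ w refl[OF w]] x by blast
  next
    assume x: "E x G"
    then have "x \<in> M w" using G trans_M[OF _ _ w] by blast
    then show "E x d"
      using total[rule_format, OF w refl[OF w] _ w refl[OF w]] x GP w refl[OF w] by blast
  qed
  then have "d = G" using universe unfolding set_universe_def by blast
  then show ?thesis using dM by simp
qed

theorem corollary24:
  fixes E :: "'u \<Rightarrow> 'u \<Rightarrow> bool"
    and K :: "'k set"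
    and R :: "('k \<times> 'k) set"
    and M :: "'k \<Rightarrow> 'u set"
  assumes "set_universe E"
    and "kripke_model_classical_domains E K R M"
    and "v \<in> K" and "w \<in> K" and "(v, w) \<in> R" and "v \<noteq> w"
    and "nontrivial_generic_extension E (M v) (M w)"
  shows "\<not> (\<forall>\<phi>\<in>CZF. kripke_valid E K R M \<phi>)"
proof
  assume valid: "\<forall>\<phi>\<in>CZF. kripke_valid E K R M \<phi>"
  let ?A = "Subset_Collection (Conj (Mem 1 2) (Impl (Mem 0 2) (Eql 1 0)))"
  \<comment> \<open>The instance has no free variables, so the closure adds no quantifier.\<close>
  have "univ_closure ?A = ?A"
    by (simp add: univ_closure_def Subset_Collection_def ForallIn_def ExistsIn_def inst_def)
  moreover have "univ_closure ?A \<in> CZF"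
    unfolding CZF_def by (intro imageI UnI2 rangeI)
  ultimately have subset_collection: "kripke_valid E K R M ?A"
    using valid by metis
  obtain P L G where P: "P \<in> M v" and generic: "generic_filter E (M v) P L G"
    and G: "G \<notin> M v" and ext: "generic_extension E (M v) P G (M w)"
    using assms(7) unfolding nontrivial_generic_extension_def by blast
  obtain p where p: "E p G" and GP: "\<And>p. E p G \<Longrightarrow> E p P"
    using generic unfolding generic_filter_def by blast
  have "transitive_ZF_model E (M v)"
    using assms(2,3) unfolding kripke_model_classical_domains_def sound_assignment_def by blast
  then have "G \<in> M w"
    using generic_extension_contains_filter[OF assms(1) _ P _ p ext] GP by blast
  then have "G \<in> M v"
    using forces_Subset_Collection_subset[OF assms(1,2) subset_collection assms(3-5) P] GP p by blast
  then show False using G by contradiction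
qed

end
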